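(* Let $X=X_\sigma$ be a three-dimensional canonical affine toric variety associated to a nondegenerate cone $\sigma\subseteq N_{\mathbb{R}}$, where $N$ has rank $3$. If $X$ admits a moderate toric resolution, then it is a crepant resolution of $X$. That is, every moderate toric resolution $X_\Sigma\to X_\sigma$ is a crepant resolution of $X_\sigma$.
   Context: Let $M$ and $N$ be free abelian groups of rank $d$ dual to each other, $N_{\mathbb{R}}=N\otimes\mathbb{R}$, $M_{\mathbb{R}}=M\otimes\mathbb{R}$, and $k$ an arbitrary field. A cone in $N_{\mathbb{R}}$ means a strongly convex, rational polyhedral cone. It is nondegenerate if it is $d$-dimensional. For a cone $\sigma$ with dual cone $\sigma^\vee\subseteq M_{\mathbb{R}}$, $X_\sigma=\operatorname{Spec} k[\sigma^\vee\cap M]$; for a fan $\Sigma$, $X_\Sigma$ is the associated toric variety. Each one-dimensional cone $\rho$ contains a unique primitive element $P(\rho)\in\rho\cap N$; $\operatorname{Gen}(\tau)$ denotes the set of the $P(\rho)$ for $\rho$ the one-dimensional faces of a cone $\tau$ (the minimal generators of $\tau$), and $\operatorname{Gen}(\Sigma)=\bigcup_{\tau\in\Sigma}\operatorname{Gen}(\tau)$ for a fan $\Sigma$. A cone is smooth if its minimal generators form part of a $\mathbb{Z}$-basis of $N$. A subdivision of $\sigma$ is a (finite) fan whose support is $\sigma$. For nondegenerate $\sigma$, $X_\sigma$ is canonical (has canonical singularities) if and only if there is $m_\sigma\in M\otimes\mathbb{Q}$ with $\langle m_\sigma,u\rangle=1$ for all $u\in\operatorname{Gen}(\sigma)$ and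 $\langle m_\sigma,n\rangle\geq 1$ for every $n\in\sigma\cap N\setminus\{0\}$. For such $\sigma$, a smooth subdivision $\Sigma$ of $\sigma$ (all cones smooth) gives a crepant resolution $X_\Sigma\to X_\sigma$ if and only if every element of $\operatorname{Gen}(\Sigma)$ lies in the affine hyperplane $\{x\mid\langle m_\sigma,x\rangle=1\}$ spanned by $\operatorname{Gen}(\sigma)$. Moderate toric resolution: a subdivision $\Sigma$ of a nondegenerate cone $\sigma\subseteq N_{\mathbb{R}}$ is a moderate toric resolution of $\sigma$ if every nondegenerate cone $\tau$ of $\Sigma$ is smooth and the affine hyperplane $\{x\in N_{\mathbb{R}}\mid l_\tau(x)=1\}$ spanned by $\operatorname{Gen}(\tau)$ intersects every one-dimensional face of $\sigma$, where $l_\tau:N_{\mathbb{R}}\to\mathbb{R}$ is the linear function sending each minimal generator of $\tau$ to $1$. The induced morphism $X_\Sigma\to X_\sigma$ is also called a moderate toric resolution. *)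

theory Defs
  imports "HOL-Analysis.Analysis"
begin

text \<open>
  The ambient type \<open>'a\<close> plays the role of \<open>N\<^sub>\<real>\<close>, and the free abelian group
  \<open>N\<close> is a full-rank lattice in it, so that the rank of \<open>N\<close> is \<open>DIM('a)\<close>.  The
  inner product of \<open>'a\<close> is never used to identify \<open>N\<close> with its dual \<open>M\<close>: elements
  of \<open>M\<close> are functionals on \<open>N\<^sub>\<real>\<close>.
\<close>

definition lattice_basis :: "'a::euclidean_space set \<Rightarrow> 'a set \<Rightarrow> bool" where
  "lattice_basis N B \<longleftrightarrow>
     independent B \<and> span B = UNIV \<and>
     N = {\<Sum>b\<in>B. real_of_int (c b) *\<^sub>R b |c. True}"

definition full_lattice :: "'a::euclidean_space set \<Rightarrow> bool" where
  "full_lattice N \<longleftrightarrow> (\<exists>B. lattice_basis N B)"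

text \<open>\<open>M \<otimes> \<rat>\<close>, where \<open>M = Hom(N, \<int>)\<close>.\<close>

definition dual_rat :: "'a::euclidean_space set \<Rightarrow> ('a \<Rightarrow> real) set" where
  "dual_rat N = {m. linear m \<and> (\<forall>n\<in>N. m n \<in> \<rat>)}"

definition toric_cone :: "'a::euclidean_space set \<Rightarrow> 'a set \<Rightarrow> bool" where
  "toric_cone N \<sigma> \<longleftrightarrow>
     (\<exists>S. finite S \<and> S \<subseteq> N \<and> \<sigma> = convex_cone hull S) \<and>
     (\<forall>x. x \<in> \<sigma> \<and> - x \<in> \<sigma> \<longrightarrow> x = 0)"

definition nondegenerate :: "'a::euclidean_space set \<Rightarrow> bool" where
  "nondegenerate \<sigma> \<longleftrightarrow> dim \<sigma> = DIM('a)"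

text \<open>The library's \<open>(face_of)\<close> also counts the empty set, which is not a face of a cone.\<close>

definition cone_face :: "'a::euclidean_space set \<Rightarrow> 'a set \<Rightarrow> bool" where
  "cone_face \<tau> \<sigma> \<longleftrightarrow> \<tau> face_of \<sigma> \<and> \<tau> \<noteq> {}"

definition cone_rays :: "'a::euclidean_space set \<Rightarrow> 'a set set" where
  "cone_rays \<sigma> = {\<rho>. cone_face \<rho> \<sigma> \<and> dim \<rho> = 1}"

definition primitive :: "'a::euclidean_space set \<Rightarrow> 'a \<Rightarrow> bool" where
  "primitive N u \<longleftrightarrow>
     u \<in> N \<and> u \<noteq> 0 \<and> (\<forall>v\<in>N. \<forall>k::nat. u = real k *\<^sub>R v \<longrightarrow> k = 1)"

definition Gen :: "'a::euclidean_space set \<Rightarrow> 'a set \<Rightarrow> 'a set" where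
  "Gen N \<tau> = {u. primitive N u \<and> (\<exists>\<rho>\<in>cone_rays \<tau>. u \<in> \<rho>)}"

definition Gen_fan :: "'a::euclidean_space set \<Rightarrow> 'a set set \<Rightarrow> 'a set" where
  "Gen_fan N \<Sigma> = (\<Union>\<tau>\<in>\<Sigma>. Gen N \<tau>)"

definition smooth_cone :: "'a::euclidean_space set \<Rightarrow> 'a set \<Rightarrow> bool" where
  "smooth_cone N \<tau> \<longleftrightarrow> (\<exists>B. lattice_basis N B \<and> Gen N \<tau> \<subseteq> B)"

definition fan :: "'a::euclidean_space set \<Rightarrow> 'a set set \<Rightarrow> bool" where
  "fan N \<Sigma> \<longleftrightarrow>
     finite \<Sigma> \<and>
     (\<forall>\<tau>\<in>\<Sigma>. toric_cone N \<tau>) \<and>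
     (\<forall>\<tau>\<in>\<Sigma>. \<forall>\<phi>. cone_face \<phi> \<tau> \<longrightarrow> \<phi> \<in> \<Sigma>) \<and>
     (\<forall>\<tau>\<in>\<Sigma>. \<forall>\<tau>'\<in>\<Sigma>. cone_face (\<tau> \<inter> \<tau>') \<tau> \<and> cone_face (\<tau> \<inter> \<tau>') \<tau>')"

definition subdivision :: "'a::euclidean_space set \<Rightarrow> 'a set set \<Rightarrow> 'a set \<Rightarrow> bool" where
  "subdivision N \<Sigma> \<sigma> \<longleftrightarrow> fan N \<Sigma> \<and> \<Union>\<Sigma> = \<sigma>"

text \<open>\<open>gen_functional N \<sigma> m\<close> says that \<open>m\<close> is the functional \<open>m\<^sub>\<sigma>\<close>; it is unique if \<open>\<sigma>\<close> is
  nondegenerate, because \<open>Gen N \<sigma>\<close> then spans \<open>N\<^sub>\<real>\<close>.\<close>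

definition gen_functional :: "'a::euclidean_space set \<Rightarrow> 'a set \<Rightarrow> ('a \<Rightarrow> real) \<Rightarrow> bool" where
  "gen_functional N \<sigma> m \<longleftrightarrow> m \<in> dual_rat N \<and> (\<forall>u\<in>Gen N \<sigma>. m u = 1)"

text \<open>
  Singularities of \<open>X\<^sub>\<sigma> = Spec k[\<sigma>\<^sup>\<or> \<inter> M]\<close> and crepancy of \<open>X\<^sub>\<Sigma> \<rightarrow> X\<^sub>\<sigma>\<close> are expressed
  by their standard criteria in terms of the cone and the fan.  These do not involve the
  base field \<open>k\<close>.  They are meant for nondegenerate \<open>\<sigma>\<close>.
\<close>

definition canonical :: "'a::euclidean_space set \<Rightarrow> 'a set \<Rightarrow> bool" where
  "canonical N \<sigma> \<longleftrightarrow>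
     (\<exists>m. gen_functional N \<sigma> m \<and> (\<forall>n\<in>\<sigma> \<inter> N - {0}. m n \<ge> 1))"

definition crepant_resolution :: "'a::euclidean_space set \<Rightarrow> 'a set set \<Rightarrow> 'a set \<Rightarrow> bool" where
  "crepant_resolution N \<Sigma> \<sigma> \<longleftrightarrow>
     subdivision N \<Sigma> \<sigma> \<and> (\<forall>\<tau>\<in>\<Sigma>. smooth_cone N \<tau>) \<and>
     (\<exists>m. gen_functional N \<sigma> m \<and> Gen_fan N \<Sigma> \<subseteq> {x. m x = 1})"

text \<open>The functional \<open>l\<close> below is \<open>l\<^sub>\<tau>\<close>; it exists and is unique when \<open>\<tau>\<close> is smooth and
  nondegenerate, because \<open>Gen N \<tau>\<close> is then a basis of \<open>N\<^sub>\<real>\<close>.\<close>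

definition moderate_resolution :: "'a::euclidean_space set \<Rightarrow> 'a set set \<Rightarrow> 'a set \<Rightarrow> bool" where
  "moderate_resolution N \<Sigma> \<sigma> \<longleftrightarrow>
     subdivision N \<Sigma> \<sigma> \<and>
     (\<forall>\<tau>\<in>\<Sigma>. nondegenerate \<tau> \<longrightarrow>
        smooth_cone N \<tau> \<and>
        (\<exists>l::'a \<Rightarrow> real. linear l \<and> (\<forall>u\<in>Gen N \<tau>. l u = 1) \<and>
           (\<forall>\<rho>\<in>cone_rays \<sigma>. {x. l x = 1} \<inter> \<rho> \<noteq> {})))"

end

theory Submission
  imports Defs
begin

text \<open>
  Let \<open>m\<close> be the functional with value \<open>1\<close> on \<open>Gen N \<sigma>\<close> given by canonicity, and let \<open>\<tau>\<close> be a
  nondegenerate cone of \<open>\<Sigma>\<close> with functional \<open>l\<close>.  As \<open>\<tau>\<close> is smooth, its minimal generators are a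
  basis of \<open>N\<close>, so \<open>l\<close> takes integer values on \<open>N\<close>.  The plane \<open>l = 1\<close> meets every ray of \<open>\<sigma>\<close>, so
  \<open>l\<close> is positive on \<open>Gen N \<sigma>\<close>; being an integer there, it is at least \<open>1\<close>, the value of \<open>m\<close>.
  Since \<open>\<sigma>\<close> is generated as a cone by \<open>Gen N \<sigma>\<close> (\<open>toric_cone_eq_hull_Gen\<close>), it follows that
  \<open>m \<le> l\<close> on all of \<open>\<sigma>\<close>.  For a minimal generator \<open>u\<close> of \<open>\<tau>\<close> this gives \<open>m u \<le> l u = 1\<close>, while
  canonicity gives \<open>1 \<le> m u\<close>.  Hence \<open>m u = 1\<close> (\<open>moderate_cone_Gen_level_one\<close>).

  The lower-dimensional cones of \<open>\<Sigma>\<close> inherit smoothness and the position of their generators,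
  because each is a face of a nondegenerate cone of \<open>\<Sigma>\<close> (\<open>subdivision_face_of_nondegenerate\<close>).
\<close>

section \<open>Minimal generators of a cone\<close>

lemma convex_cone_hull_singleton:
  "convex_cone hull {s} = {c *\<^sub>R s |c. 0 \<le> c}"
  by (auto simp: convex_cone_hull_convex_hull_nonempty)

lemma linear_le_on_convex_cone_hull:
  assumes "linear f" "linear g" "\<And>s. s \<in> S \<Longrightarrow> f s \<le> (g s :: real)" "x \<in> convex_cone hull S"
  shows "f x \<le> g x"
proof -
  have "convex_cone {x. f x \<le> g x}"
    using assms(1,2)
    by (auto simp: convex_cone_iff linear_0 linear_add linear_scale add_mono mult_left_mono)
  then have "convex_cone hull S \<subseteq> {x. f x \<le> g x}"
    using assms(3) by (intro hull_minimal) auto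
  with assms(4) show ?thesis by auto
qed

lemma convex_cone_hull_subset_span: "convex_cone hull S \<subseteq> span S"
  by (rule hull_minimal)
    (auto simp: convex_cone_iff span_superset span_add span_scale span_zero)

text \<open>
  Suppose \<open>a + b\<close> is a multiple of \<open>s\<close>, and split off from \<open>a\<close> and \<open>b\<close> their multiples of \<open>s\<close>.  The
  remainders, in the cone over the other generators, still add up to some \<open>d *\<^sub>R s\<close>.  Irredundancy
  forces \<open>d \<le> 0\<close>, and then pointedness forces both remainders to vanish.
\<close>

lemma irredundant_generator_spans_ray:
  fixes s :: "'a::euclidean_space"
  assumes pointed: "\<And>x. x \<in> convex_cone hull (insert s T) \<Longrightarrow> - x \<in> convex_cone hull (insert s T) \<Longrightarrow> x = 0"
    and irr: "s \<notin> convex_cone hull T"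
  shows "convex_cone hull {s} \<in> cone_rays (convex_cone hull (insert s T))"
proof -
  let ?K = "convex_cone hull (insert s T)" and ?C = "convex_cone hull T"
  have CK: "?C \<subseteq> ?K" and sK: "s \<in> ?K"
    by (simp_all add: hull_mono hull_inc subset_insertI)
  have s0: "s \<noteq> 0"
    using irr convex_cone_hull_contains_0 by metis
  have split: "\<exists>\<alpha> a'. a = \<alpha> *\<^sub>R s + a' \<and> 0 \<le> \<alpha> \<and> a' \<in> ?C" if "a \<in> ?K" for a
    using that convex_cone_hull_Un[of "{s}" T] by (auto simp: convex_cone_hull_singleton)
  have ray: "a \<in> convex_cone hull {s}"
    if a: "a \<in> ?K" and b: "b \<in> ?K" and ab: "a + b = c *\<^sub>R s" for a b c
  proof -
    obtain \<alpha> a' where a': "a = \<alpha> *\<^sub>R s + a'" "0 \<le> \<alpha>" "a' \<in> ?C" using split a by blast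
    obtain \<beta> b' where b': "b = \<beta> *\<^sub>R s + b'" "0 \<le> \<beta>" "b' \<in> ?C" using split b by blast
    define d where "d = c - \<alpha> - \<beta>"
    have sum: "a' + b' = d *\<^sub>R s"
      using ab a'(1) b'(1) by (simp add: d_def algebra_simps)
    have inC: "a' + b' \<in> ?C" using a' b' convex_cone_hull_add by blast
    have "d \<le> 0"
    proof (rule ccontr)
      assume "\<not> d \<le> 0"
      then have "s = (1 / d) *\<^sub>R (a' + b')" by (simp add: sum)
      with inC \<open>\<not> d \<le> 0\<close> have "s \<in> ?C"
        using convex_cone_hull_mul[of "a' + b'" T "1 / d"] by simp
      with irr show False by simp
    qed
    then have "(- d) *\<^sub>R s \<in> ?K"
      using convex_cone_hull_mul[OF sK, of "- d"] by simp
    then have "- a' \<in> ?K"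
      using convex_cone_hull_add[of "(- d) *\<^sub>R s" "insert s T" b'] b' CK sum
      by (metis add.commute add_diff_cancel_right' minus_diff_eq scaleR_minus_left subsetD
          uminus_add_conv_diff)
    then have "a' = 0" using pointed a' CK by blast
    then show ?thesis using a' by (auto simp: convex_cone_hull_singleton)
  qed
  have "convex_cone hull {s} face_of ?K"
    unfolding face_of_def
  proof (intro conjI ballI impI)
    show "convex_cone hull {s} \<subseteq> ?K" by (rule hull_mono) auto
    show "convex (convex_cone hull {s})" by (rule convex_convex_cone_hull)
    fix a b x
    assume a: "a \<in> ?K" and b: "b \<in> ?K" and x: "x \<in> convex_cone hull {s}"
      and seg: "x \<in> open_segment a b"
    obtain u where u: "0 < u" "u < 1" "x = (1 - u) *\<^sub>R a + u *\<^sub>R b"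
      using seg by (auto simp: in_segment)
    obtain c where c: "x = c *\<^sub>R s" using x by (auto simp: convex_cone_hull_singleton)
    have ua: "(1 - u) *\<^sub>R a \<in> ?K" and ub: "u *\<^sub>R b \<in> ?K"
      using u a b by (auto intro: convex_cone_hull_mul)
    have "(1 - u) *\<^sub>R a \<in> convex_cone hull {s}" "u *\<^sub>R b \<in> convex_cone hull {s}"
      using ray[OF ua ub, of c] ray[OF ub ua, of c] u c by (auto simp: add.commute)
    then have "(1 / (1 - u)) *\<^sub>R ((1 - u) *\<^sub>R a) \<in> convex_cone hull {s}"
        "(1 / u) *\<^sub>R (u *\<^sub>R b) \<in> convex_cone hull {s}"
      using u by (simp_all only: convex_cone_hull_mul divide_nonneg_nonneg zero_le_one
          less_imp_le diff_ge_0_iff_ge)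
    then show "a \<in> convex_cone hull {s}" "b \<in> convex_cone hull {s}" using u by auto
  qed
  moreover have "dim (convex_cone hull {s}) = 1"
  proof -
    have "span (convex_cone hull {s}) = span {s}"
      using convex_cone_hull_subset_span[of "{s}"]
      by (metis hull_subset span_mono span_span subset_antisym)
    then show ?thesis
      using s0 by (metis dim_span dim_singleton)
  qed
  ultimately show ?thesis
    by (auto simp: cone_rays_def cone_face_def convex_cone_hull_nonempty)
qed

text \<open>
  If \<open>s = real k *\<^sub>R v\<close> with \<open>v \<in> N\<close>, then \<open>k\<close> divides every coordinate of \<open>s\<close>, so \<open>k\<close> is bounded.
  The \<open>v\<close> that belongs to the largest \<open>k\<close> is primitive.
\<close>

lemma lattice_multiple_of_primitive:
  assumes N: "lattice_basis N B" and s: "s \<in> N" "s \<noteq> 0"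
  obtains k u where "primitive N u" "0 < k" "s = real k *\<^sub>R u"
proof -
  have ind: "independent B" and NB: "N = {\<Sum>b\<in>B. real_of_int (c b) *\<^sub>R b |c. True}"
    using N by (auto simp: lattice_basis_def)
  then have fin: "finite B" by (simp add: independent_imp_finite)
  obtain c where c: "s = (\<Sum>b\<in>B. real_of_int (c b) *\<^sub>R b)" using s NB by auto
  obtain b where b: "b \<in> B" "c b \<noteq> 0"
  proof (rule ccontr)
    assume "\<not> thesis"
    then have "\<forall>b\<in>B. c b = 0" using that by blast
    then show False using c s by simp
  qed
  let ?P = "\<lambda>k. 0 < k \<and> (\<exists>v\<in>N. s = real k *\<^sub>R v)"
  have bound: "k \<le> nat \<bar>c b\<bar>" if k: "?P k" for k
  proof -
    obtain v where v: "v \<in> N" "s = real k *\<^sub>R v" using k by auto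
    obtain e where e: "v = (\<Sum>b\<in>B. real_of_int (e b) *\<^sub>R b)" using v NB by auto
    have "(\<Sum>b\<in>B. (real_of_int (c b) - real k * real_of_int (e b)) *\<^sub>R b) = 0"
      using v(2) c e by (simp add: scaleR_diff_left sum_subtractf scaleR_sum_right)
    then have "real_of_int (c b) - real k * real_of_int (e b) = 0"
      using independentD[OF ind fin, of "\<lambda>b. real_of_int (c b) - real k * real_of_int (e b)" b] b
      by auto
    then have "real_of_int (c b) = real_of_int (int k * e b)" by simp
    then have "int k dvd c b" by (metis dvd_triv_left of_int_eq_iff)
    then show ?thesis using b(2) dvd_imp_le_int by force
  qed
  have "?P 1" using s by auto
  moreover have "\<forall>k. ?P k \<longrightarrow> k \<le> nat \<bar>c b\<bar>" using bound by iprover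
  ultimately have "\<exists>k. ?P k \<and> (\<forall>j. ?P j \<longrightarrow> j \<le> k)"
    by (rule Nat.ex_has_greatest_nat)
  then obtain k where k: "?P k" and max: "\<And>j. ?P j \<Longrightarrow> j \<le> k" by iprover
  then obtain u where u: "u \<in> N" "s = real k *\<^sub>R u" by auto
  have "j = 1" if v: "v \<in> N" "u = real j *\<^sub>R v" for v j
  proof -
    have "j \<noteq> 0" using v u s by auto
    moreover have "k * j \<le> k"
      using v u k \<open>j \<noteq> 0\<close> by (intro max) auto
    ultimately show "j = 1" using k by auto
  qed
  moreover have "u \<noteq> 0" using u s by auto
  ultimately have "primitive N u" using u(1) unfolding primitive_def by blast
  then show thesis using that k u by blast
qed

text \<open>
  A generating set of least cardinality is irredundant, so each of its elements lies on a ray of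
  the cone and is therefore a positive multiple of a minimal generator.
\<close>

lemma toric_cone_eq_hull_Gen:
  assumes N: "full_lattice N" and \<sigma>: "toric_cone N \<sigma>"
  shows "\<sigma> = convex_cone hull (Gen N \<sigma>)"
proof
  obtain B where B: "lattice_basis N B" using N by (auto simp: full_lattice_def)
  let ?P = "\<lambda>S. finite S \<and> S \<subseteq> N \<and> \<sigma> = convex_cone hull S"
  have pointed: "x = 0" if "x \<in> \<sigma>" "- x \<in> \<sigma>" for x using \<sigma> that by (auto simp: toric_cone_def)
  obtain S0 where "?P S0" using \<sigma> by (auto simp: toric_cone_def)
  then obtain S where S: "?P S" and min: "\<And>T. ?P T \<Longrightarrow> card S \<le> card T"
    using ex_has_least_nat[of ?P S0 card] by blast
  have "s \<in> convex_cone hull (Gen N \<sigma>)" if s: "s \<in> S" for s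
  proof -
    define T where "T = S - {s}"
    have ST: "S = insert s T" using s by (auto simp: T_def)
    have irr: "s \<notin> convex_cone hull T"
    proof
      assume "s \<in> convex_cone hull T"
      then have "?P T" using S ST hull_redundant[of s convex_cone T] by auto
      then have "card S \<le> card T" by (rule min)
      then show False using S s card_Diff1_less[of S s] by (simp add: T_def)
    qed
    have ray: "convex_cone hull {s} \<in> cone_rays \<sigma>"
      using irredundant_generator_spans_ray[of s T] pointed irr S ST by auto
    have "s \<noteq> 0" using irr convex_cone_hull_contains_0 by metis
    then obtain k u where u: "primitive N u" "0 < k" "s = real k *\<^sub>R u"
      using lattice_multiple_of_primitive[OF B] S s by blast
    have "u = (1 / real k) *\<^sub>R s" using u by simp
    then have "u \<in> convex_cone hull {s}"
      by (metis (mono_tags, lifting) convex_cone_hull_mul hull_inc singletonI divide_nonneg_nonneg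
          of_nat_0_le_iff zero_le_one)
    then have "u \<in> Gen N \<sigma>" using u ray by (auto simp: Gen_def)
    then show ?thesis using u by (auto intro: convex_cone_hull_mul hull_inc)
  qed
  then have "S \<subseteq> convex_cone hull (Gen N \<sigma>)" by auto
  then show "\<sigma> \<subseteq> convex_cone hull (Gen N \<sigma>)"
    using S by (metis hull_minimal convex_cone_convex_cone_hull)
  have "Gen N \<sigma> \<subseteq> \<sigma>"
    by (auto simp: Gen_def cone_rays_def cone_face_def dest: face_of_imp_subset)
  then show "convex_cone hull (Gen N \<sigma>) \<subseteq> \<sigma>"
    using S by (metis hull_minimal convex_cone_convex_cone_hull)
qed

lemma Gen_subset: "Gen N \<tau> \<subseteq> \<tau> \<inter> N - {0}"
  by (auto simp: Gen_def cone_rays_def cone_face_def primitive_def dest: face_of_imp_subset)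

lemma Gen_face_subset:
  assumes "cone_face \<phi> \<tau>"
  shows "Gen N \<phi> \<subseteq> Gen N \<tau>"
  using assms unfolding Gen_def cone_rays_def cone_face_def by (blast intro: face_of_trans)

lemma lattice_basis_Gen:
  assumes N: "full_lattice N" and \<tau>: "toric_cone N \<tau>" "nondegenerate \<tau>" "smooth_cone N \<tau>"
  shows "lattice_basis N (Gen N \<tau>)"
proof -
  obtain B where B: "lattice_basis N B" "Gen N \<tau> \<subseteq> B" using \<tau> by (auto simp: smooth_cone_def)
  have "\<tau> \<subseteq> span (Gen N \<tau>)"
    using toric_cone_eq_hull_Gen[OF N \<tau>(1)] convex_cone_hull_subset_span by blast
  moreover have "span \<tau> = UNIV"
    using \<tau>(2) by (simp add: nondegenerate_def dim_eq_full)
  ultimately have "span (Gen N \<tau>) = UNIV" by (metis span_mono span_span top.extremum_uniqueI)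
  then have "Gen N \<tau> = B"
    using B spanning_subset_independent[of "Gen N \<tau>" B] by (auto simp: lattice_basis_def)
  with B show ?thesis by simp
qed

section \<open>Cones of a subdivision\<close>

text \<open>
  The cones of \<open>\<Sigma>\<close> of lower dimension together form a null set, so the nondegenerate ones already
  cover the interior of \<open>\<sigma>\<close>; their union is closed, so it is all of \<open>\<sigma>\<close>.  A nondegenerate cone
  that contains a relative interior point of \<open>\<tau>\<close> then has \<open>\<tau>\<close> as a face.
\<close>

lemma subdivision_face_of_nondegenerate:
  assumes \<sigma>: "toric_cone N \<sigma>" "nondegenerate \<sigma>" and \<Sigma>: "subdivision N \<Sigma> \<sigma>" and \<tau>: "\<tau> \<in> \<Sigma>"
  obtains \<tau>' where "\<tau>' \<in> \<Sigma>" "nondegenerate \<tau>'" "cone_face \<tau> \<tau>'"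
proof -
  have fan: "fan N \<Sigma>" and cover: "\<Union>\<Sigma> = \<sigma>" using \<Sigma> by (auto simp: subdivision_def)
  then have fin: "finite \<Sigma>" by (auto simp: fan_def)
  have cone: "closed \<phi> \<and> convex \<phi> \<and> 0 \<in> \<phi>" if "toric_cone N \<phi>" for \<phi>
    using that by (auto simp: toric_cone_def closed_convex_cone_hull convex_convex_cone_hull
        convex_cone_hull_contains_0)
  have cone\<Sigma>: "closed \<phi> \<and> convex \<phi> \<and> 0 \<in> \<phi>" if "\<phi> \<in> \<Sigma>" for \<phi>
    using that fan cone by (auto simp: fan_def)
  define U where "U = \<Union>{\<phi> \<in> \<Sigma>. nondegenerate \<phi>}"
  have closedU: "closed U" unfolding U_def using fin cone\<Sigma> by (intro closed_Union) auto
  have "negligible (\<Union>{\<phi> \<in> \<Sigma>. \<not> nondegenerate \<phi>})"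
  proof (rule negligible_Union)
    fix \<phi> assume "\<phi> \<in> {\<phi> \<in> \<Sigma>. \<not> nondegenerate \<phi>}"
    then have "dim \<phi> < DIM('a)"
      using dim_subset_UNIV[of \<phi>] by (auto simp: nondegenerate_def)
    then show "negligible \<phi>" by (rule negligible_lowdim)
  qed (use fin in auto)
  moreover have "interior \<sigma> - U \<subseteq> \<Union>{\<phi> \<in> \<Sigma>. \<not> nondegenerate \<phi>}"
    using interior_subset[of \<sigma>] cover by (auto simp: U_def)
  ultimately have "negligible (interior \<sigma> - U)" by (rule negligible_subset)
  moreover have "open (interior \<sigma> - U)" using closedU by (simp add: open_Diff)
  ultimately have intU: "interior \<sigma> \<subseteq> U" using open_not_negligible by blast
  have "aff_dim \<sigma> = int DIM('a)"
    using \<sigma>(2) cone[OF \<sigma>(1)] by (simp add: nondegenerate_def aff_dim_zero hull_inc)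
  then have "interior \<sigma> \<noteq> {}"
    using cone[OF \<sigma>(1)] by (metis empty_iff interior_rel_interior_gen rel_interior_eq_empty)
  then have "\<sigma> \<subseteq> closure (interior \<sigma>)"
    using cone[OF \<sigma>(1)] by (simp add: convex_closure_interior closure_subset)
  then have \<sigma>U: "\<sigma> \<subseteq> U" using closure_minimal[OF intU closedU] by blast
  obtain x where x: "x \<in> rel_interior \<tau>"
    using cone\<Sigma>[OF \<tau>] rel_interior_eq_empty[of \<tau>] by auto
  then have x\<tau>: "x \<in> \<tau>" using rel_interior_subset by blast
  then have "x \<in> U" using \<sigma>U \<tau> cover by auto
  then obtain \<tau>' where \<tau>': "\<tau>' \<in> \<Sigma>" "nondegenerate \<tau>'" "x \<in> \<tau>'" by (auto simp: U_def)
  have faces: "\<tau> \<inter> \<tau>' face_of \<tau>" "cone_face (\<tau> \<inter> \<tau>') \<tau>'"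
    using fan \<tau> \<tau>' by (auto simp: fan_def cone_face_def)
  have "\<tau> \<subseteq> \<tau> \<inter> \<tau>'"
    using subset_of_face_of[OF faces(1) order_refl] x x\<tau> \<tau>'(3) by blast
  then have "\<tau> \<inter> \<tau>' = \<tau>" by auto
  then show thesis using that \<tau>' faces by simp
qed

section \<open>Moderate resolutions of canonical cones\<close>

lemma moderate_cone_Gen_level_one:
  assumes N: "full_lattice N" and \<sigma>: "toric_cone N \<sigma>"
    and m: "linear m" "\<And>u. u \<in> Gen N \<sigma> \<Longrightarrow> m u = 1" "\<And>n. n \<in> \<sigma> \<inter> N - {0} \<Longrightarrow> m n \<ge> (1::real)"
    and \<tau>: "toric_cone N \<tau>" "nondegenerate \<tau>" "smooth_cone N \<tau>" "\<tau> \<subseteq> \<sigma>"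
    and l: "linear l" "\<And>u. u \<in> Gen N \<tau> \<Longrightarrow> l u = 1"
      "\<And>\<rho>. \<rho> \<in> cone_rays \<sigma> \<Longrightarrow> {x. l x = (1::real)} \<inter> \<rho> \<noteq> {}"
    and u: "u \<in> Gen N \<tau>"
  shows "m u = 1"
proof -
  have int: "l n \<in> \<int>" if "n \<in> N" for n
  proof -
    have "n \<in> {\<Sum>b\<in>Gen N \<tau>. real_of_int (c b) *\<^sub>R b |c. True}"
      using that lattice_basis_Gen[OF N \<tau>(1-3)] unfolding lattice_basis_def by metis
    then obtain c where "n = (\<Sum>b\<in>Gen N \<tau>. real_of_int (c b) *\<^sub>R b)" by auto
    then have "l n = (\<Sum>b\<in>Gen N \<tau>. real_of_int (c b))"
      using l by (simp add: linear_sum linear_scale)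
    then show ?thesis by (simp add: Ints_sum)
  qed
  have "1 \<le> l w" if w: "w \<in> Gen N \<sigma>" for w
  proof -
    obtain \<rho> where \<rho>: "\<rho> \<in> cone_rays \<sigma>" "w \<in> \<rho>" and w0: "w \<noteq> 0" "w \<in> N"
      using w by (auto simp: Gen_def primitive_def)
    obtain x where x: "x \<in> \<rho>" "l x = 1" using l(3)[OF \<rho>(1)] by auto
    have face: "\<rho> face_of \<sigma>" and dim: "dim \<rho> = 1" using \<rho> by (auto simp: cone_rays_def cone_face_def)
    have "\<rho> \<subseteq> span {w}"
      using dim w0 \<rho>(2)
      by (metis card_eq_dim dim_eq_span dim_singleton empty_subsetI insert_subset order_refl
          span_superset)
    then obtain t where t: "x = t *\<^sub>R w" using x by (auto simp: span_singleton)
    \<comment> \<open>\<open>\<sigma>\<close> is pointed, so \<open>x\<close> cannot lie on the opposite side of the origin from \<open>w\<close>.\<close>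
    have "0 < t"
    proof (rule ccontr)
      assume "\<not> 0 < t"
      have "t \<noteq> 0" using t x l(1) by (auto simp: linear_0)
      with \<open>\<not> 0 < t\<close> have "t < 0" by simp
      have xs: "x \<in> \<sigma>" "w \<in> \<sigma>" using face x \<rho> face_of_imp_subset by blast+
      have "- w = (- 1 / t) *\<^sub>R x" using t \<open>t < 0\<close> by simp
      then have "- w \<in> \<sigma>"
        using xs \<sigma> \<open>t < 0\<close> convex_cone_hull_mul[of x _ "- 1 / t"]
        by (auto simp: toric_cone_def divide_nonpos_neg)
      then show False using xs w0 \<sigma> by (auto simp: toric_cone_def)
    qed
    moreover have "t * l w = 1" using t x l(1) by (simp add: linear_scale)
    ultimately have "0 < l w" by (metis zero_less_mult_pos zero_less_one)
    with int[OF w0(2)] show ?thesis by (auto elim!: Ints_cases)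
  qed
  then have "m w \<le> l w" if "w \<in> Gen N \<sigma>" for w using m(2) that by simp
  moreover have "u \<in> convex_cone hull (Gen N \<sigma>)"
    using u \<tau>(4) Gen_subset toric_cone_eq_hull_Gen[OF N \<sigma>] by blast
  ultimately have "m u \<le> l u" using linear_le_on_convex_cone_hull m(1) l(1) by blast
  then have "m u \<le> 1" using l(2) u by simp
  moreover have "1 \<le> m u" using u \<tau>(4) Gen_subset by (intro m(3)) blast
  ultimately show ?thesis by simp
qed

theorem corollary1p9:
  fixes N \<sigma> :: "'a::euclidean_space set" and \<Sigma> :: "'a set set"
  assumes "DIM('a) = 3"
    and "full_lattice N"
    and "toric_cone N \<sigma>"
    and "nondegenerate \<sigma>"
    and "canonical N \<sigma>"
    and "moderate_resolution N \<Sigma> \<sigma>"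
  shows "crepant_resolution N \<Sigma> \<sigma>"
proof -
  obtain m where m: "gen_functional N \<sigma> m" "\<And>n. n \<in> \<sigma> \<inter> N - {0} \<Longrightarrow> m n \<ge> 1"
    using assms(5) by (auto simp: canonical_def)
  then have m': "linear m" "\<And>u. u \<in> Gen N \<sigma> \<Longrightarrow> m u = 1"
    by (auto simp: gen_functional_def dual_rat_def)
  have sub: "subdivision N \<Sigma> \<sigma>" using assms(6) by (simp add: moderate_resolution_def)
  have key: "smooth_cone N \<tau> \<and> (\<forall>u\<in>Gen N \<tau>. m u = 1)" if \<tau>: "\<tau> \<in> \<Sigma>" for \<tau>
  proof -
    obtain \<tau>' where \<tau>': "\<tau>' \<in> \<Sigma>" "nondegenerate \<tau>'" "cone_face \<tau> \<tau>'"
      using subdivision_face_of_nondegenerate[OF assms(3,4) sub \<tau>] .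
    have cone': "toric_cone N \<tau>'" "\<tau>' \<subseteq> \<sigma>" using sub \<tau>' by (auto simp: subdivision_def fan_def)
    have "smooth_cone N \<tau>' \<and>
        (\<exists>l::'a \<Rightarrow> real. linear l \<and> (\<forall>u\<in>Gen N \<tau>'. l u = 1) \<and>
           (\<forall>\<rho>\<in>cone_rays \<sigma>. {x. l x = 1} \<inter> \<rho> \<noteq> {}))"
      using assms(6) \<tau>' unfolding moderate_resolution_def by simp
    then obtain l where smooth': "smooth_cone N \<tau>'"
      and l: "linear l" "\<And>u. u \<in> Gen N \<tau>' \<Longrightarrow> l u = 1"
        "\<And>\<rho>. \<rho> \<in> cone_rays \<sigma> \<Longrightarrow> {x. l x = (1::real)} \<inter> \<rho> \<noteq> {}"
      by auto
    have "m u = 1" if "u \<in> Gen N \<tau>'" for u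
      using moderate_cone_Gen_level_one[OF assms(2,3) m' m(2) cone'(1) \<tau>'(2) smooth' cone'(2) l that]
      by blast
    then show ?thesis
      using Gen_face_subset[OF \<tau>'(3)] smooth' unfolding smooth_cone_def by blast
  qed
  then show ?thesis
    using sub m(1) by (auto simp: crepant_resolution_def Gen_fan_def)
qed

end
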